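(* Let $X,Y$ be reflexive Banach spaces endowed with a Fréchet-smooth norm. Consider a map $f:X\to Y$ of the form $f=g+h$, where $g,h:X\to Y$ satisfy: (i) $g$ is $C^1$-smooth on all of $X$, and $g'(x)$ is an isomorphism for each $x\in X$. (ii) $h$ is locally Lipschitz, and $\mathrm{Lip}\,h(x)<\|g'(x)^{-1}\|^{-1}$ for each $x\in X$. (iii) The following integral condition holds: $$\int_0^\infty\inf_{\|x\|\le t}\left(\|g'(x)^{-1}\|^{-1}-\mathrm{Lip}\,h(x)\right)dt=\infty.$$ Then $f$ is a global homeomorphism from $X$ onto $Y$, whose inverse is Lipschitz on bounded subsets of $Y$.
   Context: Banach spaces are real. A norm is Fréchet-smooth if it is Fréchet differentiable at every nonzero point. An isomorphism is a bounded linear bijection with bounded inverse. For a map $h:U\subset X\to Y$ locally Lipschitz at $x$ (i.e. Lipschitz on some open ball around $x$), the local Lipschitz constant is $\mathrm{Lip}\,h(x)=\inf_{r>0}\sup\left\{\frac{\|h(u)-h(v)\|}{\|u-v\|} : u,v\in B(x,r),\ u\ne v\right\}$, where $B(x,r)$ is the open ball. *)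

theory Defs
  imports "HOL-Analysis.Analysis"
begin

text \<open>The canonical embedding into the bidual.  The operand of \<open>Blinfun\<close> is bounded linear,
  so no default value is involved.\<close>

definition bidual_embedding :: "'a::real_normed_vector \<Rightarrow> ('a \<Rightarrow>\<^sub>L real) \<Rightarrow>\<^sub>L real" where
  "bidual_embedding x = Blinfun (\<lambda>\<phi>. blinfun_apply \<phi> x)"

lemma bidual_embedding_apply: "blinfun_apply (bidual_embedding x) \<phi> = blinfun_apply \<phi> x"
  unfolding bidual_embedding_def
  by (simp add: bounded_linear_Blinfun_apply blinfun.bounded_linear_left)

definition reflexive_space :: "'a::real_normed_vector itself \<Rightarrow> bool" where
  "reflexive_space _ \<longleftrightarrow> surj (bidual_embedding :: 'a \<Rightarrow> ('a \<Rightarrow>\<^sub>L real) \<Rightarrow>\<^sub>L real)"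

definition frechet_smooth_norm :: "'a::real_normed_vector itself \<Rightarrow> bool" where
  "frechet_smooth_norm _ \<longleftrightarrow> (\<forall>x::'a. x \<noteq> 0 \<longrightarrow> norm differentiable (at x))"

definition normed_isomorphism :: "('a::real_normed_vector \<Rightarrow> 'b::real_normed_vector) \<Rightarrow> bool" where
  "normed_isomorphism T \<longleftrightarrow> bounded_linear T \<and> bij T \<and> bounded_linear (inv T)"

definition lipschitz_near :: "('a::metric_space \<Rightarrow> 'b::metric_space) \<Rightarrow> 'a \<Rightarrow> bool" where
  "lipschitz_near h x \<longleftrightarrow> (\<exists>r>0. \<exists>L. L-lipschitz_on (ball x r) h)"

text \<open>The local Lipschitz constant takes values in \<^typ>\<open>ennreal\<close>, so that the infimum and the
  supremum are those of a complete lattice (it is finite iff \<open>h\<close> is Lipschitz near \<open>x\<close>, and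
  the supremum is 0 if the ball has only one point).\<close>

definition local_Lip :: "('a::real_normed_vector \<Rightarrow> 'b::real_normed_vector) \<Rightarrow> 'a \<Rightarrow> ennreal" where
  "local_Lip h x =
     (INF r\<in>{0::real<..}. SUP (u, v)\<in>{(u, v). u \<in> ball x r \<and> v \<in> ball x r \<and> u \<noteq> v}.
        ennreal (norm (h u - h v) / norm (u - v)))"

text \<open>\<open>\<parallel>T\<^sup>-\<^sup>1\<parallel>\<^sup>-\<^sup>1\<close> for an isomorphism \<open>T\<close>, again in \<^typ>\<open>ennreal\<close>: it is
  \<open>\<infinity>\<close> exactly for zero-dimensional spaces, where \<open>T\<^sup>-\<^sup>1 = 0\<close>.\<close>

definition inverse_norm_recip ::
    "('a::real_normed_vector \<Rightarrow> 'b::real_normed_vector) \<Rightarrow> ennreal" where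
  "inverse_norm_recip T = inverse (ennreal (onorm (inv T)))"

end

theory Submission imports Defs begin

text \<open>
  The argument is Hadamard's: \<open>f\<close> is a local homeomorphism whose local inverses have controlled
  Lipschitz constants, the integral condition prevents lifts of segments from escaping to infinity
  in finite time, and a map along which segments can be lifted is bijective because segments
  contract the target to a point.

  \<^bold>\<open>Local behaviour.\<close>  Write \<open>m x = \<parallel>g'(x)\<^sup>-\<^sup>1\<parallel>\<^sup>-\<^sup>1 - Lip h(x)\<close> and let \<open>0 < c < m x\<close>.  Near \<open>x\<close>, the map
  \<open>f\<close> is the isomorphism \<open>T = g' x\<close> plus a remainder with Lipschitz constant \<open>\<parallel>T\<^sup>-\<^sup>1\<parallel>\<^sup>-\<^sup>1 - c\<close>
  (\<open>perturbation_lipschitz_near\<close>).  As \<open>T\<close> stretches by at least \<open>\<parallel>T\<^sup>-\<^sup>1\<parallel>\<^sup>-\<^sup>1\<close>, near \<open>x\<close> the map \<open>f\<close>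
  stretches distances by at least \<open>c\<close>, and the contraction principle makes it open at \<open>x\<close>.

  \<^bold>\<open>A priori bound.\<close>  Let \<open>w t\<close> be the infimum of \<open>m\<close> on the ball of radius \<open>t\<close>, and \<open>F\<close> its
  integral from 0.  Suppose a path \<open>p\<close> starts at \<open>x\<close> and \<open>f \<circ> p\<close> runs along the segment from
  \<open>f x\<close> to \<open>y\<close>.  The speed of \<open>p\<close> is essentially at most \<open>\<parallel>y - f x\<parallel> / w \<parallel>p t\<parallel>\<close>, so \<open>F \<parallel>p t\<parallel>\<close> grows
  at a rate of at most \<open>\<parallel>y - f x\<parallel>\<close>.  Since \<open>F\<close> is unbounded, \<open>p\<close> stays in a ball that depends
  only on \<open>\<parallel>x\<parallel>\<close> and \<open>\<parallel>y - f x\<parallel>\<close>; there \<open>w\<close> is bounded below, so \<open>p\<close> is Lipschitz.  Hence a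
  partial lift has a limit at its end point, can be continued beyond it, and thus extends to
  the whole segment (\<open>lift_exists\<close>).

  \<^bold>\<open>Global conclusion.\<close>  Lifting the segment from \<open>f 0\<close> to \<open>y\<close> gives surjectivity.  For injectivity,
  fix \<open>y\<close> and send every \<open>x\<close> to the end point of the lift that starts at \<open>x\<close> and lies over the
  segment from \<open>f x\<close> to \<open>y\<close>.  This map is locally constant (\<open>lift_stable\<close>), hence constant, and it
  fixes every preimage of \<open>y\<close>; so there is only one preimage.  Finally the inverse maps a segment
  of a ball to its lift, and the Lipschitz bound for lifts becomes one for the inverse.
\<close>

section \<open>An unbounded integral of the weight\<close>

text \<open>
  The integral \<open>F r\<close> of \<open>w\<close> over \<open>[0, r]\<close> is a witness.  On \<open>[s, t]\<close> the integrand is at most its value at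
  the left end, so the growth estimate survives the jumps of \<open>w\<close>.
\<close>
lemma primitive_of_antimono_weight:
  fixes w :: "real \<Rightarrow> real"
  assumes nonneg: "\<And>t. 0 \<le> t \<Longrightarrow> 0 \<le> w t"
    and anti: "\<And>s t. 0 \<le> s \<Longrightarrow> s \<le> t \<Longrightarrow> w t \<le> w s"
    and div: "(\<integral>\<^sup>+ t\<in>{0..}. ennreal (w t) \<partial>lborel) = \<infinity>"
  obtains F :: "real \<Rightarrow> real" where
    "\<And>s t. 0 \<le> s \<Longrightarrow> s \<le> t \<Longrightarrow> F s \<le> F t"
    "\<And>s t. 0 \<le> s \<Longrightarrow> s \<le> t \<Longrightarrow> F t - F s \<le> w s * (t - s)"
    "\<And>M. \<exists>r\<ge>0. M < F r"
proof -
  \<comment> \<open>Made constant to the left of 0, the weight is monotone on the whole line, hence measurable.\<close>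
  define v where "v t = w (max 0 t)" for t
  have v_nonneg: "0 \<le> v t" and v_anti: "s \<le> t \<Longrightarrow> v t \<le> v s" for s t
    using nonneg anti[of "max 0 s" "max 0 t"] by (auto simp: v_def)
  have "(\<lambda>t. - v t) \<in> borel_measurable borel"
    by (rule borel_measurable_mono) (simp add: mono_def v_anti)
  then have "(\<lambda>t. - (- v t)) \<in> borel_measurable borel" by (rule borel_measurable_uminus)
  then have [measurable]: "v \<in> borel_measurable borel" by simp
  define G where "G r = (\<integral>\<^sup>+ t\<in>{0..r}. ennreal (v t) \<partial>lborel)" for r
  have G_split: "G t = G s + (\<integral>\<^sup>+ u\<in>{s<..t}. ennreal (v u) \<partial>lborel)" if "0 \<le> s" "s \<le> t" for s t
  proof -
    have "G t = (\<integral>\<^sup>+ u. (ennreal (v u) * indicator {0..s} u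
        + ennreal (v u) * indicator {s<..t} u) \<partial>lborel)"
      unfolding G_def using that by (intro nn_integral_cong) (auto simp: indicator_def)
    also have "\<dots> = G s + (\<integral>\<^sup>+ u\<in>{s<..t}. ennreal (v u) \<partial>lborel)"
      unfolding G_def by (rule nn_integral_add) auto
    finally show ?thesis .
  qed
  have piece: "(\<integral>\<^sup>+ u\<in>{s<..t}. ennreal (v u) \<partial>lborel) \<le> ennreal (v s * (t - s))"
    if "s \<le> t" for s t
  proof -
    have "(\<integral>\<^sup>+ u\<in>{s<..t}. ennreal (v u) \<partial>lborel)
        \<le> (\<integral>\<^sup>+ u. ennreal (v s) * indicator {s<..t} u \<partial>lborel)"
      by (intro nn_integral_mono) (auto simp: indicator_def v_anti intro!: ennreal_leI)
    also have "\<dots> = ennreal (v s * (t - s))"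
      using that v_nonneg by (simp add: nn_integral_cmult_indicator ennreal_mult)
    finally show ?thesis .
  qed
  have "G 0 \<le> (\<integral>\<^sup>+ u. ennreal (v 0) * indicator {0..0::real} u \<partial>lborel)"
    unfolding G_def by (intro nn_integral_mono) (auto simp: indicator_def)
  also have "\<dots> = 0" by (subst nn_integral_cmult_indicator) auto
  finally have G0: "G 0 = 0" by simp
  have G_fin: "G r < \<infinity>" if "0 \<le> r" for r
    using G_split[OF order_refl that] piece[OF that] G0 by (auto simp: top.not_eq_extremum intro: le_less_trans)
  show ?thesis
  proof (rule that[of "\<lambda>r. enn2real (G r)"])
    fix s t :: real assume st: "0 \<le> s" "s \<le> t"
    have "G s \<le> G t" using G_split[OF st] by simp
    then show "enn2real (G s) \<le> enn2real (G t)"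
      using G_fin st by (intro enn2real_mono) auto
    have "G t \<le> G s + ennreal (v s * (t - s))"
      unfolding G_split[OF st] by (intro add_left_mono piece st)
    also have "\<dots> = ennreal (enn2real (G s) + v s * (t - s))"
      using G_fin[OF st(1)] v_nonneg st by (simp add: ennreal_plus)
    finally have "enn2real (G t) \<le> enn2real (G s) + v s * (t - s)"
      using v_nonneg st by (intro enn2real_leI) auto
    then show "enn2real (G t) - enn2real (G s) \<le> w s * (t - s)"
      using st by (simp add: v_def)
  next
    fix M :: real
    have "(SUP n. G (real n)) = (\<integral>\<^sup>+ t. (SUP n. ennreal (v t) * indicator {0..real n} t) \<partial>lborel)"
      unfolding G_def
      by (rule nn_integral_monotone_convergence_SUP[symmetric])
        (auto simp: incseq_def le_fun_def indicator_def)
    also have "\<dots> = (\<integral>\<^sup>+ t\<in>{0..}. ennreal (w t) \<partial>lborel)"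
    proof (rule nn_integral_cong)
      fix t :: real
      show "(SUP n. ennreal (v t) * indicator {0..real n} t) = ennreal (w t) * indicator {0..} t"
      proof (rule antisym)
        show "(SUP n. ennreal (v t) * indicator {0..real n} t) \<le> ennreal (w t) * indicator {0..} t"
          by (rule SUP_least) (auto simp: indicator_def v_def)
        obtain n where "t \<le> real n" using real_arch_simple by blast
        then have "ennreal (w t) * indicator {0..} t \<le> ennreal (v t) * indicator {0..real n} t"
          by (auto simp: indicator_def v_def)
        also have "\<dots> \<le> (SUP n. ennreal (v t) * indicator {0..real n} t)"
          by (rule SUP_upper) simp
        finally show "ennreal (w t) * indicator {0..} t \<le> (SUP n. ennreal (v t) * indicator {0..real n} t)" .
      qed
    qed
    finally have "(SUP n. G (real n)) = \<infinity>" using div by simp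
    then have "ennreal (max 0 M) < (SUP n. G (real n))" by (simp only: ennreal_less_top infinity_ennreal_def)
    then obtain n where "ennreal (max 0 M) < G (real n)" by (auto simp: less_SUP_iff)
    also have "\<dots> = ennreal (enn2real (G (real n)))" using G_fin[of "real n"] by simp
    finally have "max 0 M < enn2real (G (real n))" by (simp add: ennreal_less_iff)
    then show "\<exists>r\<ge>0. M < enn2real (G r)" by (intro exI[of _ "real n"]) simp
  qed
qed

section \<open>Small Lipschitz perturbations of isomorphisms\<close>
lemma normed_isomorphism_bounds:
  assumes "normed_isomorphism T"
  shows "norm (inv T y) \<le> onorm (inv T) * norm y" "norm v \<le> onorm (inv T) * norm (T v)"
    "T (inv T y) = y" "inv T (T v) = v"
proof -
  have T: "bij T" "bounded_linear (inv T)" using assms by (auto simp: normed_isomorphism_def)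
  show le: "norm (inv T y) \<le> onorm (inv T) * norm y" for y by (rule onorm[OF T(2)])
  show inv: "T (inv T y) = y" "inv T (T v) = v"
    using T(1) by (simp_all add: bij_is_surj surj_f_inv_f bij_is_inj)
  show "norm v \<le> onorm (inv T) * norm (T v)" using le[of "T v"] inv by simp
qed

lemma perturbed_isomorphism_expansive:
  assumes T: "normed_isomorphism T" and pos: "onorm (inv T) > 0"
    and k: "q-lipschitz_on U k" and uv: "u \<in> U" "v \<in> U"
  shows "(1 / onorm (inv T) - q) * norm (u - v) \<le> norm ((T u + k u) - (T v + k v))"
proof -
  have lin: "bounded_linear T" using T by (simp add: normed_isomorphism_def)
  have "norm (u - v) / onorm (inv T) \<le> norm (T (u - v))"
    using normed_isomorphism_bounds(2)[OF T, of "u - v"] pos by (simp add: field_simps)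
  moreover have "norm (k u - k v) \<le> q * norm (u - v)"
    using lipschitz_onD[OF k uv] by (simp add: dist_norm)
  moreover have "(T u + k u) - (T v + k v) = T (u - v) + (k u - k v)"
    by (simp add: bounded_linear.linear[OF lin] linear_diff)
  moreover have "norm (T (u - v)) - norm (k u - k v) \<le> norm (T (u - v) + (k u - k v))"
    by (rule norm_diff_ineq)
  ultimately show ?thesis by (simp add: algebra_simps)
qed

text \<open>
  To solve \<open>T u + k u = y\<close> means to find a fixed point of \<open>u \<mapsto> T\<^sup>-\<^sup>1 (y - k u)\<close>, which is a contraction
  with constant \<open>q * \<parallel>T\<^sup>-\<^sup>1\<parallel>\<close>.
\<close>
lemma perturbed_isomorphism_open:
  fixes T k :: "'a::banach \<Rightarrow> 'b::real_normed_vector"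
  assumes T: "normed_isomorphism T" and pos: "onorm (inv T) > 0"
    and k: "q-lipschitz_on (ball x r) k" and q: "q * onorm (inv T) < 1" and r: "r > 0"
  shows "\<exists>\<rho>>0. ball (T x + k x) \<rho> \<subseteq> (\<lambda>u. T u + k u) ` ball x r"
proof -
  define n where "n = onorm (inv T)"
  have n: "n > 0" using pos by (simp add: n_def)
  have S: "bounded_linear (inv T)" using T by (simp add: normed_isomorphism_def)
  have q0: "q \<ge> 0" by (rule lipschitz_on_nonneg[OF k])
  define s where "s = r / 2"
  have s: "s > 0" "cball x s \<subseteq> ball x r" using r by (auto simp: s_def)
  \<comment> \<open>The largest \<open>\<rho>\<close> with \<open>n * (\<rho> + q * s) \<le> s\<close>: the fixed point map then preserves \<open>cball x s\<close>.\<close>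
  define \<rho> where "\<rho> = (1 - q * n) * s / n"
  have \<rho>: "\<rho> > 0" using q s n by (simp add: \<rho>_def n_def)
  have "y \<in> (\<lambda>u. T u + k u) ` ball x r" if y: "y \<in> ball (T x + k x) \<rho>" for y
  proof -
    define \<Phi> where "\<Phi> u = inv T (y - k u)" for u
    have diff: "norm (\<Phi> u - inv T z) \<le> n * norm (y - k u - z)" for u z
      using normed_isomorphism_bounds(1)[OF T, of "y - k u - z"]
      by (simp add: \<Phi>_def n_def linear_diff[OF bounded_linear.linear[OF S]])
    have "\<exists>!u\<in>cball x s. \<Phi> u = u"
    proof (rule Banach_fix)
      show "complete (cball x s)" by (simp add: complete_eq_closed)
      show "cball x s \<noteq> {}" using s by simp
      show "0 \<le> n * q" "n * q < 1" using n q0 q by (simp_all add: n_def mult.commute)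
      show "\<Phi> ` cball x s \<subseteq> cball x s"
      proof clarify
        fix u assume u: "u \<in> cball x s"
        have "norm (\<Phi> u - x) \<le> n * norm (y - k u - T x)"
          using diff[of u "T x"] normed_isomorphism_bounds(4)[OF T] by simp
        also have "y - k u - T x = (y - (T x + k x)) + (k x - k u)" by simp
        also have "n * norm ((y - (T x + k x)) + (k x - k u)) \<le> n * (\<rho> + q * s)"
        proof (intro mult_left_mono norm_triangle_le add_mono)
          show "norm (y - (T x + k x)) \<le> \<rho>"
            using y by (simp add: dist_norm norm_minus_commute)
          have "norm (k x - k u) \<le> q * dist x u"
            using lipschitz_onD[OF k, of x u] s u r by (auto simp: dist_norm)
          also have "\<dots> \<le> q * s" using u q0 by (intro mult_left_mono) auto
          finally show "norm (k x - k u) \<le> q * s" .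
        qed (use n in simp)
        also have "\<dots> = s" using n by (simp add: \<rho>_def field_simps)
        finally show "\<Phi> u \<in> cball x s" by (simp add: dist_norm norm_minus_commute)
      qed
      show "dist (\<Phi> u) (\<Phi> v) \<le> n * q * dist u v" if "u \<in> cball x s" "v \<in> cball x s" for u v
      proof -
        have "dist (\<Phi> u) (\<Phi> v) \<le> n * norm (y - k u - (y - k v))"
          using diff[of u "y - k v"] by (simp add: \<Phi>_def dist_norm)
        also have "\<dots> = n * dist (k u) (k v)" by (simp add: dist_norm norm_minus_commute)
        also have "\<dots> \<le> n * (q * dist u v)"
          using lipschitz_onD[OF k subsetD[OF s(2)] subsetD[OF s(2)], OF that] n
          by (intro mult_left_mono) auto
        finally show ?thesis by (simp add: mult.assoc)
      qed
    qed
    then obtain u where u: "u \<in> cball x s" "\<Phi> u = u" by blast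
    then have "T u = y - k u" using normed_isomorphism_bounds(3)[OF T] by (metis \<Phi>_def)
    then show ?thesis using u(1) s(2) by (intro image_eqI[of _ _ u]) auto
  qed
  then show ?thesis using \<rho> by blast
qed

lemma lipschitz_on_ball_of_local_Lip_less:
  assumes "local_Lip h x < ennreal q"
  obtains r where "r > 0" "q-lipschitz_on (ball x r) h"
proof -
  obtain r where r: "r > 0"
    and less: "(SUP (u, v)\<in>{(u, v). u \<in> ball x r \<and> v \<in> ball x r \<and> u \<noteq> v}.
        ennreal (norm (h u - h v) / norm (u - v))) < ennreal q"
    using assms unfolding local_Lip_def INF_less_iff by auto
  have q: "q > 0" using assms by (metis ennreal_neg linorder_not_less not_less_zero)
  have "q-lipschitz_on (ball x r) h"
  proof (rule lipschitz_onI)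
    fix u v assume uv: "u \<in> ball x r" "v \<in> ball x r"
    show "dist (h u) (h v) \<le> q * dist u v"
    proof (cases "u = v")
      case False
      have "ennreal (norm (h u - h v) / norm (u - v)) \<le>
         (SUP (u, v)\<in>{(u, v). u \<in> ball x r \<and> v \<in> ball x r \<and> u \<noteq> v}.
        ennreal (norm (h u - h v) / norm (u - v)))"
        by (rule SUP_upper2[of "(u, v)"]) (use uv False in auto)
      also note less
      finally have "norm (h u - h v) / norm (u - v) < q" by (simp add: ennreal_less_iff)
      then show ?thesis using False by (simp add: dist_norm field_simps)
    qed simp
  qed (use q in simp)
  with r that show ?thesis by blast
qed

lemma C1_remainder_lipschitz:
  fixes g' :: "'a::real_normed_vector \<Rightarrow> 'a \<Rightarrow>\<^sub>L 'b::real_normed_vector"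
  assumes der: "\<And>x. (g has_derivative blinfun_apply (g' x)) (at x)"
    and cont: "isCont g' x" and \<epsilon>: "\<epsilon> > 0"
  obtains r where "r > 0" "\<epsilon>-lipschitz_on (ball x r) (\<lambda>u. g u - blinfun_apply (g' x) u)"
proof -
  obtain r where r: "r > 0" "\<And>u. dist u x < r \<Longrightarrow> dist (g' u) (g' x) < \<epsilon>"
    using cont \<epsilon> unfolding continuous_at_eps_delta by blast
  have "\<epsilon>-lipschitz_on (ball x r) (\<lambda>u. g u - blinfun_apply (g' x) u)"
  proof (rule lipschitz_onI)
    fix u v assume uv: "u \<in> ball x r" "v \<in> ball x r"
    have "norm ((g u - g' x u) - (g v - g' x v)) \<le> \<epsilon> * norm (u - v)"
    proof (rule differentiable_bound[OF convex_ball _ _ uv])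
      fix z assume z: "z \<in> ball x r"
      have "((\<lambda>u. g u - g' x u) has_derivative (\<lambda>u. g' z u - g' x u)) (at z)"
        by (intro derivative_intros der)
          (simp add: blinfun.bounded_linear_right bounded_linear_imp_has_derivative)
      then show "((\<lambda>u. g u - g' x u) has_derivative blinfun_apply (g' z - g' x)) (at z within ball x r)"
        by (simp add: minus_blinfun.rep_eq has_derivative_at_withinI)
      have "norm (g' z - g' x) \<le> \<epsilon>"
        using r(2)[of z] z by (simp add: dist_norm norm_minus_commute)
      then show "onorm (blinfun_apply (g' z - g' x)) \<le> \<epsilon>" by (simp add: norm_blinfun.rep_eq)
    qed
    then show "dist (g u - g' x u) (g v - g' x v) \<le> \<epsilon> * dist u v" by (simp add: dist_norm)
  qed (use \<epsilon> in simp)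
  with r that show ?thesis by blast
qed

text \<open>
  The gap between \<open>\<parallel>g'(x)\<^sup>-\<^sup>1\<parallel>\<^sup>-\<^sup>1 - c\<close> and \<open>Lip h(x)\<close> is shared out: \<open>h\<close> gets a Lipschitz constant
  \<open>q\<close> strictly in between, and the nonlinear part of \<open>g\<close> gets what remains above \<open>q\<close>.
\<close>
lemma perturbation_lipschitz_near:
  fixes g' :: "'a::real_normed_vector \<Rightarrow> 'a \<Rightarrow>\<^sub>L 'b::real_normed_vector"
  assumes der: "\<And>x. (g has_derivative blinfun_apply (g' x)) (at x)"
    and cont: "isCont g' x"
    and pos: "onorm (inv (blinfun_apply (g' x))) > 0"
    and c: "0 < c" "ennreal c < inverse_norm_recip (blinfun_apply (g' x)) - local_Lip h x"
  obtains r where "r > 0"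
    "(1 / onorm (inv (blinfun_apply (g' x))) - c)-lipschitz_on (ball x r)
       (\<lambda>u. g u + h u - blinfun_apply (g' x) u)"
proof -
  define m where "m = 1 / onorm (inv (blinfun_apply (g' x)))"
  have m: "inverse_norm_recip (blinfun_apply (g' x)) = ennreal m"
    using pos by (simp add: inverse_norm_recip_def inverse_ennreal m_def inverse_eq_divide)
  define l where "l = enn2real (local_Lip h x)"
  have "local_Lip h x \<noteq> top" using c(2) by (auto simp: m)
  then have l: "local_Lip h x = ennreal l" "0 \<le> l" by (simp_all add: l_def less_top)
  have "ennreal c < ennreal (m - l)" using c(2) by (simp add: m l ennreal_minus)
  then have "c < m - l" using c(1) by (simp add: ennreal_less_iff)
  define q where "q = (l + (m - c)) / 2"
  have q: "local_Lip h x < ennreal q" "q < m - c"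
    using \<open>c < m - l\<close> l(2) by (auto simp: q_def l(1) ennreal_less_iff)
  obtain r1 where r1: "r1 > 0" "q-lipschitz_on (ball x r1) h"
    using lipschitz_on_ball_of_local_Lip_less[OF q(1)] by blast
  obtain r2 where r2: "r2 > 0" "(m - c - q)-lipschitz_on (ball x r2) (\<lambda>u. g u - blinfun_apply (g' x) u)"
    using C1_remainder_lipschitz[OF der cont, of "m - c - q"] q(2) by auto
  have "(q + (m - c - q))-lipschitz_on (ball x (min r1 r2))
     (\<lambda>u. h u + (g u - blinfun_apply (g' x) u))"
    by (intro lipschitz_on_add lipschitz_on_subset[OF r1(2)] lipschitz_on_subset[OF r2(2)]) auto
  moreover have "(\<lambda>u. h u + (g u - blinfun_apply (g' x) u)) = (\<lambda>u. g u + h u - blinfun_apply (g' x) u)"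
    by (simp add: fun_eq_iff)
  ultimately have "(1 / onorm (inv (blinfun_apply (g' x))) - c)-lipschitz_on (ball x (min r1 r2))
     (\<lambda>u. g u + h u - blinfun_apply (g' x) u)" by (simp only: m_def) simp
  then show ?thesis using r1(1) r2(1) by (intro that[of "min r1 r2"]) auto
qed


section \<open>Growth from one-sided difference quotients\<close>

text \<open>
  The last point up to which the estimate holds must be \<open>b\<close>, since from every earlier point a
  further step is possible.  Requiring only one good step to the right of each point is what
  makes the lemma applicable to \<open>F \<parallel>p t\<parallel>\<close>, where a left-hand estimate can fail at jumps of the weight.
\<close>
lemma one_sided_growth:
  fixes \<phi> :: "real \<Rightarrow> real"
  assumes ab: "a \<le> b" and cont: "continuous_on {a..b} \<phi>"
    and step: "\<And>t. a \<le> t \<Longrightarrow> t < b \<Longrightarrow> \<exists>s>t. s \<le> b \<and> \<phi> s - \<phi> t \<le> K * (s - t)"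
  shows "\<phi> b - \<phi> a \<le> K * (b - a)"
proof -
  define S where "S = {t\<in>{a..b}. \<phi> t \<le> \<phi> a + K * (t - a)}"
  have "closed S"
    unfolding S_def
    by (rule continuous_on_closed_Collect_le[OF cont]) (auto intro!: continuous_intros)
  moreover have "S \<subseteq> {a..b}" by (auto simp: S_def)
  ultimately have "compact S"
    by (metis bounded_closed_interval bounded_subset compact_eq_bounded_closed)
  moreover have "a \<in> S" using ab by (simp add: S_def)
  ultimately obtain t where t: "t \<in> S" and tmax: "\<And>s. s \<in> S \<Longrightarrow> s \<le> t"
    using compact_attains_sup[of S] by auto
  have "t = b"
  proof (rule ccontr)
    assume "t \<noteq> b"
    with t have "a \<le> t" "t < b" by (auto simp: S_def)
    then obtain s where s: "s > t" "s \<le> b" "\<phi> s - \<phi> t \<le> K * (s - t)"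
      using step by blast
    moreover have "\<phi> t \<le> \<phi> a + K * (t - a)" using t by (simp add: S_def)
    ultimately have "s \<in> S"
      using \<open>a \<le> t\<close> by (auto simp: S_def algebra_simps)
    with tmax s show False by force
  qed
  with t show ?thesis by (simp add: S_def)
qed

section \<open>Lifting segments along a locally expanding open map\<close>

text \<open>
  The stretching factor at \<open>x\<close> is bounded below by a decreasing function \<open>\<eta>\<close> of \<open>\<parallel>x\<parallel>\<close>.  The function
  \<open>F\<close> plays the role of a divergent integral of \<open>\<eta>\<close>; it appears as a parameter because only
  monotonicity, a one-sided growth estimate and unboundedness matter.
\<close>
locale weighted_expansion =
  fixes f :: "'a::banach \<Rightarrow> 'b::real_normed_vector" and \<eta> F :: "real \<Rightarrow> real"
  assumes continuous: "continuous_on UNIV f"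
    and expansive: "\<And>x. \<exists>r>0. \<forall>u\<in>ball x r. \<forall>v\<in>ball x r.
          \<eta> (norm x) * norm (u - v) \<le> norm (f u - f v)"
    and open_at: "\<And>x r. r > 0 \<Longrightarrow> \<exists>\<rho>>0. ball (f x) \<rho> \<subseteq> f ` ball x r"
    and antimono: "\<And>s t. 0 \<le> s \<Longrightarrow> s \<le> t \<Longrightarrow> \<eta> t \<le> \<eta> s"
    and F_mono: "\<And>s t. 0 \<le> s \<Longrightarrow> s \<le> t \<Longrightarrow> F s \<le> F t"
    and F_growth: "\<And>s t. 0 \<le> s \<Longrightarrow> s \<le> t \<Longrightarrow> F t - F s \<le> \<eta> s * (t - s)"
    and F_unbounded: "\<And>M. \<exists>r\<ge>0. M < F r"
begin

text \<open>
  If \<open>\<eta> s \<le> 0\<close>, then \<open>F\<close> cannot grow beyond \<open>s\<close>, contrary to its unboundedness.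
\<close>
lemma weight_pos: "\<eta> s > 0" if "s \<ge> 0"
proof (rule ccontr)
  assume neg: "\<not> \<eta> s > 0"
  obtain r where r: "r \<ge> 0" "F s < F r" using F_unbounded by blast
  then have "s \<le> r" using F_mono[of r s] by linarith
  then have "F r - F s \<le> \<eta> s * (r - s)" using F_growth that by blast
  also have "\<dots> \<le> 0" using neg \<open>s \<le> r\<close> by (simp add: mult_nonpos_nonneg)
  finally show False using r by simp
qed

lemma F_continuous: "continuous_on {0..} F"
proof -
  have le: "\<bar>F t - F s\<bar> \<le> \<eta> 0 * \<bar>t - s\<bar>" if "0 \<le> s" "s \<le> t" for s t
  proof -
    have "F t - F s \<le> \<eta> s * (t - s)" using F_growth that by blast
    also have "\<dots> \<le> \<eta> 0 * (t - s)" using antimono[of 0 s] that by (simp add: mult_right_mono)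
    finally show ?thesis using F_mono[OF that] that by simp
  qed
  have "dist (F s) (F t) \<le> \<eta> 0 * dist s t" if "s \<in> {0..}" "t \<in> {0..}" for s t
    using le[of s t] le[of t s] that
    by (cases "s \<le> t") (simp_all add: dist_real_def abs_minus_commute)
  then have "(\<eta> 0)-lipschitz_on {0..} F"
    using weight_pos[of 0] by (intro lipschitz_onI) auto
  then show ?thesis by (rule lipschitz_on_continuous_on)
qed

text \<open>
  The whole segment from \<open>f x\<close> to \<open>y\<close> corresponds to \<open>T = 1\<close>; other end times allow partial lifts
  to be compared and continued.
\<close>
definition lift :: "(real \<Rightarrow> 'a) \<Rightarrow> 'a \<Rightarrow> 'b \<Rightarrow> real \<Rightarrow> bool" where
  "lift p x y T \<longleftrightarrow> continuous_on {0..T} p \<and> p 0 = x \<and>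
     (\<forall>t\<in>{0..T}. f (p t) = f x + t *\<^sub>R (y - f x))"

lemma lift_restrict: "lift p x y T \<Longrightarrow> T' \<le> T \<Longrightarrow> lift p x y T'"
  unfolding lift_def by (auto intro: continuous_on_subset)

lemma lift_end: "f (p 1) = y" if "lift p x y 1"
  using that by (simp add: lift_def)

lemma lift_image_dist:
  assumes "lift p x y T" "s \<in> {0..T}" "t \<in> {0..T}"
  shows "norm (f (p s) - f (p t)) = norm (y - f x) * \<bar>s - t\<bar>"
proof -
  have "f (p s) - f (p t) = (s - t) *\<^sub>R (y - f x)"
    using assms by (simp add: lift_def algebra_simps)
  then show ?thesis by simp
qed

text \<open>
  The infinitesimal speed bound, in the form that \<open>one_sided_growth\<close> consumes.
\<close>
lemma lift_speed:
  assumes p: "lift p x y T" and t: "0 \<le> t" "t < b" "b \<le> T"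
  shows "\<exists>s>t. s \<le> b \<and> \<eta> (norm (p t)) * norm (p s - p t) \<le> norm (y - f x) * (s - t)"
proof -
  obtain r where r: "r > 0" and exp: "\<And>u v. u \<in> ball (p t) r \<Longrightarrow> v \<in> ball (p t) r \<Longrightarrow>
      \<eta> (norm (p t)) * norm (u - v) \<le> norm (f u - f v)"
    using expansive[of "p t"] by blast
  have "continuous_on {0..T} p" using p by (simp add: lift_def)
  moreover have "t \<in> {0..T}" using t by simp
  ultimately obtain d where d: "d > 0"
    "\<And>s. s \<in> {0..T} \<Longrightarrow> dist s t < d \<Longrightarrow> dist (p s) (p t) < r"
    using r unfolding continuous_on_iff by blast
  define s where "s = min b (t + d / 2)"
  have s: "t < s" "s \<le> b" "dist s t < d" "s \<in> {0..T}"
    using t d(1) by (auto simp: s_def dist_real_def)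
  then have "p s \<in> ball (p t) r" using d(2) by (simp add: dist_commute)
  then have "\<eta> (norm (p t)) * norm (p s - p t) \<le> norm (f (p s) - f (p t))"
    using exp r by simp
  also have "\<dots> = norm (y - f x) * (s - t)"
    using lift_image_dist[OF p, of s t] s t by simp
  finally show ?thesis using s by blast
qed

text \<open>
  In the quantity \<open>F \<parallel>p t\<parallel>\<close> the growth estimate for \<open>F\<close> contributes the factor \<open>\<eta> \<parallel>p t\<parallel>\<close>, which
  cancels against the same factor in the speed bound.  Steps that bring \<open>p\<close> closer to the origin
  do not increase \<open>F\<close> and need no estimate.
\<close>
lemma lift_weight_bound:
  assumes p: "lift p x y T" and "0 \<le> T"
  shows "F (norm (p T)) \<le> F (norm x) + norm (y - f x) * T"
proof -
  have cp: "continuous_on {0..T} p" and p0: "p 0 = x" using p by (auto simp: lift_def)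
  have "F (norm (p T)) - F (norm (p 0)) \<le> norm (y - f x) * (T - 0)"
  proof (rule one_sided_growth[OF \<open>0 \<le> T\<close>])
    show "continuous_on {0..T} (\<lambda>t. F (norm (p t)))"
      by (rule continuous_on_compose2[OF F_continuous]) (auto intro!: continuous_intros cp)
    fix t assume t: "0 \<le> t" "t < T"
    obtain s where s: "s > t" "s \<le> T"
      and sp: "\<eta> (norm (p t)) * norm (p s - p t) \<le> norm (y - f x) * (s - t)"
      using lift_speed[OF p t order_refl] by blast
    have "F (norm (p s)) - F (norm (p t)) \<le> norm (y - f x) * (s - t)"
    proof (cases "norm (p t) \<le> norm (p s)")
      case True
      then have "F (norm (p s)) - F (norm (p t)) \<le> \<eta> (norm (p t)) * (norm (p s) - norm (p t))"
        using F_growth by simp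
      also have "\<dots> \<le> \<eta> (norm (p t)) * norm (p s - p t)"
        using weight_pos[of "norm (p t)"] by (intro mult_left_mono norm_triangle_ineq2) auto
      finally show ?thesis using sp by simp
    next
      case False
      then have "F (norm (p s)) \<le> F (norm (p t))" using F_mono by simp
      moreover have "norm (y - f x) * (s - t) \<ge> 0" using s by simp
      ultimately show ?thesis by linarith
    qed
    with s show "\<exists>s>t. s \<le> T \<and> F (norm (p s)) - F (norm (p t)) \<le> norm (y - f x) * (s - t)"
      by blast
  qed
  then show ?thesis using p0 by simp
qed

lemma lift_in_ball:
  assumes p: "lift p x y T" and t: "0 \<le> t" "t \<le> T" "t \<le> 1"
    and R: "0 \<le> R" "F (norm x) + norm (y - f x) < F R"
  shows "norm (p t) \<le> R"
proof (rule ccontr)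
  assume "\<not> norm (p t) \<le> R"
  then have "F R \<le> F (norm (p t))" using F_mono[of R "norm (p t)"] R by simp
  also have "\<dots> \<le> F (norm x) + norm (y - f x) * t"
    using lift_weight_bound[OF lift_restrict[OF p t(2)] t(1)] .
  also have "\<dots> \<le> F (norm x) + norm (y - f x)"
    using t by (simp add: mult_left_le)
  finally show False using R by simp
qed

lemma lift_lipschitz:
  assumes p: "lift p x y T" and bd: "\<And>u. u \<in> {0..T} \<Longrightarrow> norm (p u) \<le> R"
    and st: "0 \<le> s" "s \<le> t" "t \<le> T"
  shows "\<eta> R * norm (p t - p s) \<le> norm (y - f x) * (t - s)"
proof -
  have cp: "continuous_on {0..T} p" using p by (simp add: lift_def)
  have "0 \<le> R" using order_trans[OF norm_ge_zero bd[of s]] st by simp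
  note Rpos = weight_pos[OF this]
  have "\<eta> R * norm (p t - p s) - \<eta> R * norm (p s - p s) \<le> norm (y - f x) * (t - s)"
  proof (rule one_sided_growth[OF st(2)])
    show "continuous_on {s..t} (\<lambda>u. \<eta> R * norm (p u - p s))"
      using st by (intro continuous_intros continuous_on_subset[OF cp]) auto
    fix u assume u: "s \<le> u" "u < t"
    obtain v where v: "v > u" "v \<le> t"
      and sp: "\<eta> (norm (p u)) * norm (p v - p u) \<le> norm (y - f x) * (v - u)"
      using lift_speed[OF p _ u(2) st(3)] u st by auto
    have "\<eta> R * norm (p v - p s) - \<eta> R * norm (p u - p s)
        = \<eta> R * (norm (p v - p s) - norm (p u - p s))" by (simp add: algebra_simps)
    also have "\<dots> \<le> \<eta> R * norm (p v - p u)"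
      using Rpos norm_triangle_ineq2[of "p v - p s" "p u - p s"] by (intro mult_left_mono) auto
    also have "\<dots> \<le> \<eta> (norm (p u)) * norm (p v - p u)"
      using bd[of u] u st by (intro mult_right_mono antimono) auto
    also note sp
    finally show "\<exists>v>u. v \<le> t \<and>
        \<eta> R * norm (p v - p s) - \<eta> R * norm (p u - p s) \<le> norm (y - f x) * (v - u)"
      using v by blast
  qed
  then show ?thesis by simp
qed

text \<open>
  A Lebesgue number for the cover of \<open>C\<close> by the balls of local expansion makes the radius uniform,
  and boundedness of \<open>C\<close> makes the factor uniform.
\<close>
lemma compact_uniformly_expansive:
  assumes "compact C"
  obtains c \<delta> where "c > 0" "\<delta> > 0"
    "\<And>u v. u \<in> C \<Longrightarrow> v \<in> ball u \<delta> \<Longrightarrow> c * norm (u - v) \<le> norm (f u - f v)"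
proof -
  obtain R where R: "R > 0" "\<And>x. x \<in> C \<Longrightarrow> norm x \<le> R"
    using compact_imp_bounded[OF assms] unfolding bounded_pos by blast
  have "\<forall>x. \<exists>r>0. \<forall>u\<in>ball x r. \<forall>v\<in>ball x r.
      \<eta> (norm x) * norm (u - v) \<le> norm (f u - f v)"
    by (rule allI) (rule expansive)
  from choice[OF this] obtain r where r: "\<And>x. r x > 0"
    and exp: "\<And>x u v. u \<in> ball x (r x) \<Longrightarrow> v \<in> ball x (r x) \<Longrightarrow>
      \<eta> (norm x) * norm (u - v) \<le> norm (f u - f v)"
    by blast
  have "C \<subseteq> \<Union> ((\<lambda>x. ball x (r x)) ` C)" using r by force
  moreover have "open G" if "G \<in> (\<lambda>x. ball x (r x)) ` C" for G using that by auto
  ultimately obtain \<delta> where \<delta>: "\<delta> > 0"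
    "\<And>u. u \<in> C \<Longrightarrow> \<exists>G\<in>(\<lambda>x. ball x (r x)) ` C. ball u \<delta> \<subseteq> G"
    using Heine_Borel_lemma[OF assms] by blast
  show ?thesis
  proof (rule that[of "\<eta> R" \<delta>])
    show "\<eta> R > 0" using weight_pos R by simp
    show "\<delta> > 0" by fact
    fix u v assume u: "u \<in> C" and v: "v \<in> ball u \<delta>"
    obtain x where x: "x \<in> C" "ball u \<delta> \<subseteq> ball x (r x)" using \<delta>(2)[OF u] by blast
    have "\<eta> R * norm (u - v) \<le> \<eta> (norm x) * norm (u - v)"
      using R(2)[OF x(1)] by (intro mult_right_mono antimono) auto
    also have "\<dots> \<le> norm (f u - f v)"
      using subsetD[OF x(2) v] subsetD[OF x(2), of u] \<delta>(1) by (intro exp) simp_all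
    finally show "\<eta> R * norm (u - v) \<le> norm (f u - f v)" .
  qed
qed

text \<open>
  Two lifts over segments with a common end point \<open>y\<close> have images at distance
  \<open>(1 - t) \<parallel>f x' - f x\<parallel>\<close>.  As long as they are closer than the radius \<open>\<delta>\<close> of uniform expansion
  along \<open>p\<close>, which holds at the start if \<open>x'\<close> is near \<open>x\<close>, they are therefore
  within \<open>\<parallel>f x' - f x\<parallel> / c < \<delta>\<close> of each other, so by continuity they can never get as far apart as \<open>\<delta>\<close>.  Within that radius \<open>f\<close> separates points.  The hypothesis
  \<open>f (p t) = f (q t)\<close> holds in two situations of interest: at all times if \<open>x' = x\<close>, which
  yields uniqueness of lifts, and at \<open>t = 1\<close> for every \<open>x'\<close>, which makes end points locally constant.
\<close>
lemma lift_stable: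
  assumes p: "lift p x y T" and T1: "T \<le> 1"
  obtains \<epsilon> where "\<epsilon> > 0"
    "\<And>q x' T' t. \<lbrakk>lift q x' y T'; T' \<le> T; x' \<in> ball x \<epsilon>; t \<in> {0..T'}; f (p t) = f (q t)\<rbrakk>
       \<Longrightarrow> q t = p t"
proof -
  have cp: "continuous_on {0..T} p" and p0: "p 0 = x" using p by (auto simp: lift_def)
  then have "compact (p ` {0..T})" by (simp add: compact_continuous_image)
  then obtain c \<delta> where c: "c > 0" and \<delta>: "\<delta> > 0"
    and exp': "\<And>u v. u \<in> p ` {0..T} \<Longrightarrow> v \<in> ball u \<delta> \<Longrightarrow>
        c * norm (u - v) \<le> norm (f u - f v)"
    using compact_uniformly_expansive by blast
  have exp: "c * norm (p t - v) \<le> norm (f (p t) - f v)"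
    if "t \<in> {0..T}" "v \<in> ball (p t) \<delta>" for t v
    using that by (intro exp') auto
  have "isCont f x" using continuous by (simp add: continuous_on_eq_continuous_at)
  moreover have "c * \<delta> > 0" using c \<delta> by simp
  ultimately obtain e where e: "e > 0" "\<And>x'. dist x' x < e \<Longrightarrow> dist (f x') (f x) < c * \<delta>"
    unfolding continuous_at_eps_delta by blast
  show ?thesis
  proof (rule that[of "min e \<delta>"])
    show "min e \<delta> > 0" using e \<delta> by simp
    fix q x' T' t
    assume q: "lift q x' y T'" and T': "T' \<le> T" and x': "x' \<in> ball x (min e \<delta>)"
      and t: "t \<in> {0..T'}" and eq: "f (p t) = f (q t)"
    have cq: "continuous_on {0..T'} q" and q0: "q 0 = x'" using q by (auto simp: lift_def)
    define d where "d = max (norm (f x' - f x) / c) (norm (x' - x))"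
    have d: "d < \<delta>"
      using e(2)[of x'] x' c by (auto simp: d_def dist_norm norm_minus_commute field_simps)
    have gap: "norm (f (p s) - f (q s)) \<le> norm (f x' - f x)" if "s \<in> {0..T'}" for s
    proof -
      have "f (p s) - f (q s) = (1 - s) *\<^sub>R (f x - f x')"
        using p q that T' by (simp add: lift_def algebra_simps)
      then have "norm (f (p s) - f (q s)) = (1 - s) * norm (f x' - f x)"
        using that T' T1 by (simp add: norm_minus_commute)
      also have "\<dots> \<le> norm (f x' - f x)" using that T' T1 by (simp add: mult_left_le_one_le)
      finally show ?thesis .
    qed
    have near: "norm (q s - p s) < \<delta>" if s: "s \<in> {0..T'}" for s
    proof (rule ccontr)
      assume far: "\<not> norm (q s - p s) < \<delta>"
      \<comment> \<open>A distance strictly between the bound \<open>d\<close> and \<open>\<delta>\<close>; on the way to \<open>\<delta>\<close> it would be attained.\<close>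
      define d' where "d' = (d + \<delta>) / 2"
      have d': "d < d'" "d' < \<delta>" using d by (auto simp: d'_def)
      have "continuous_on {0..s} (\<lambda>u. norm (q u - p u))"
        using s T' by (intro continuous_intros continuous_on_subset[OF cp]
            continuous_on_subset[OF cq]) auto
      moreover have "norm (q 0 - p 0) \<le> d'" using p0 q0 d' by (simp add: d_def)
      ultimately obtain u where u: "0 \<le> u" "u \<le> s" "norm (q u - p u) = d'"
        using IVT'[of "\<lambda>u. norm (q u - p u)" 0 d' s] far d' s by auto
      then have "c * d' \<le> norm (f (p u) - f (q u))"
        using exp[of u "q u"] s T' d' by (simp add: dist_norm norm_minus_commute)
      also have "\<dots> \<le> norm (f x' - f x)" using gap u s by simp
      also have "\<dots> \<le> c * d"
        using c by (simp add: d_def max_def field_simps)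
      finally show False using c d' by simp
    qed
    have "c * norm (p t - q t) \<le> norm (f (p t) - f (q t))"
      using near[OF t] t T' by (intro exp) (auto simp: dist_norm norm_minus_commute)
    with eq c show "q t = p t" by (simp add: mult_le_0_iff)
  qed
qed

lemma lift_unique:
  assumes p: "lift p x y T" and q: "lift q x y T'" and t: "0 \<le> t" "t \<le> T" "t \<le> T'" "t \<le> 1"
  shows "q t = p t"
proof -
  have p': "lift p x y t" and q': "lift q x y t" using p q t lift_restrict by blast+
  have "f (p t) = f (q t)" using p' q' t by (simp add: lift_def)
  moreover obtain \<epsilon> where "\<epsilon> > 0"
    "\<And>q x' T' s. \<lbrakk>lift q x' y T'; T' \<le> t; x' \<in> ball x \<epsilon>; s \<in> {0..T'}; f (p s) = f (q s)\<rbrakk>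
       \<Longrightarrow> q s = p s" using lift_stable[OF p' t(4)] by blast
  ultimately show ?thesis using q' t by simp
qed

text \<open>
  Openness of \<open>f\<close> at \<open>p T\<close> supplies preimages of the next piece of the segment, and local expansion
  makes them a Lipschitz function of the time.
\<close>
lemma lift_extend:
  assumes p: "lift p x y T" and T: "0 \<le> T"
  shows "\<exists>T'>T. \<exists>q. lift q x y T'"
proof -
  define seg where "seg t = f x + t *\<^sub>R (y - f x)" for t
  have cp: "continuous_on {0..T} p" and p0: "p 0 = x"
    and fp: "\<And>t. t \<in> {0..T} \<Longrightarrow> f (p t) = seg t" using p by (auto simp: lift_def seg_def)
  have seg_dist: "norm (seg s - seg t) = norm (y - f x) * \<bar>s - t\<bar>" for s t
  proof -
    have "seg s - seg t = (s - t) *\<^sub>R (y - f x)" by (simp add: seg_def algebra_simps)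
    then show ?thesis by simp
  qed
  define c where "c = \<eta> (norm (p T))"
  have c: "c > 0" using weight_pos by (simp add: c_def)
  obtain r where r: "r > 0" and exp: "\<And>u v. u \<in> ball (p T) r \<Longrightarrow> v \<in> ball (p T) r \<Longrightarrow>
      c * norm (u - v) \<le> norm (f u - f v)"
    using expansive[of "p T"] unfolding c_def by blast
  obtain \<rho> where \<rho>: "\<rho> > 0" "ball (f (p T)) \<rho> \<subseteq> f ` ball (p T) r"
    using open_at r by blast
  \<comment> \<open>The summand 1 covers the degenerate segment \<open>y = f x\<close>.\<close>
  define \<delta> where "\<delta> = \<rho> / (norm (y - f x) + 1)"
  have \<delta>: "\<delta> > 0" using \<rho> by (simp add: \<delta>_def add_nonneg_pos)
  have small: "norm (y - f x) * \<bar>s - T\<bar> < \<rho>" if "s \<in> {T..T + \<delta>}" for s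
  proof -
    have "norm (y - f x) * \<bar>s - T\<bar> \<le> norm (y - f x) * \<delta>" using that by (intro mult_left_mono) auto
    also have "\<dots> < (norm (y - f x) + 1) * \<delta>" using \<delta> by (simp add: distrib_right)
    also have "\<dots> = \<rho>"
      using add_nonneg_pos[OF norm_ge_zero[of "y - f x"] zero_less_one] by (simp add: \<delta>_def)
    finally show ?thesis .
  qed
  have "seg s \<in> f ` ball (p T) r" if "s \<in> {T..T + \<delta>}" for s
    using \<rho>(2) small[OF that] fp[of T] T seg_dist[of s T]
    by (auto simp: dist_norm norm_minus_commute)
  then have "\<forall>s\<in>{T..T + \<delta>}. \<exists>v. v \<in> ball (p T) r \<and> f v = seg s" by (metis imageE)
  from bchoice[OF this] obtain q where
    q: "\<And>s. s \<in> {T..T + \<delta>} \<Longrightarrow> q s \<in> ball (p T) r" "\<And>s. s \<in> {T..T + \<delta>} \<Longrightarrow> f (q s) = seg s"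
    by blast
  have "(norm (y - f x) / c)-lipschitz_on {T..T + \<delta>} q"
  proof (rule lipschitz_onI)
    fix s t assume st: "s \<in> {T..T + \<delta>}" "t \<in> {T..T + \<delta>}"
    have "c * norm (q s - q t) \<le> norm (y - f x) * \<bar>s - t\<bar>"
      using exp[OF q(1) q(1), OF st] q(2)[OF st(1)] q(2)[OF st(2)] seg_dist[of s t] by simp
    then show "dist (q s) (q t) \<le> norm (y - f x) / c * dist s t"
      using c by (simp add: dist_norm field_simps)
  qed (use c in simp)
  then have cq: "continuous_on {T..T + \<delta>} q" by (rule lipschitz_on_continuous_on)
  have qT: "q T = p T"
  proof -
    have "c * norm (q T - p T) \<le> norm (f (q T) - f (p T))" using exp q(1)[of T] r \<delta> by simp
    also have "\<dots> = 0" using q(2)[of T] fp[of T] \<delta> T by simp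
    finally show ?thesis using c by (simp add: mult_le_0_iff)
  qed
  have split: "{0..T + \<delta>} = {0..T} \<union> {T..T + \<delta>}" using T \<delta> by auto
  have "continuous_on {0..T + \<delta>} (\<lambda>t. if t \<le> T then p t else q t)"
    unfolding split by (rule continuous_on_If) (use cp cq qT in auto)
  then have "lift (\<lambda>t. if t \<le> T then p t else q t) x y (T + \<delta>)"
    using p0 fp q(2) T by (auto simp: lift_def seg_def)
  then show ?thesis using \<delta> by (intro exI[of _ "T + \<delta>"] conjI exI) auto
qed

text \<open>
  The times up to which a lift exists form an interval.  It contains its supremum, because the
  lifts agree with each other and are uniformly Lipschitz on the ball of radius \<open>R\<close>, so that they
  converge in the complete space \<open>'a\<close>; and it has no largest element below 1 by \<open>lift_extend\<close>.
\<close>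
lemma lift_exists: "\<exists>p. lift p x y 1"
proof -
  obtain R where R: "R \<ge> 0" "F (norm x) + norm (y - f x) < F R" using F_unbounded by blast
  define S where "S = {T\<in>{0..1}. \<exists>p. lift p x y T}"
  have zero: "0 \<in> S" by (auto simp: S_def lift_def intro: exI[of _ "\<lambda>_. x"])
  have bdd: "bdd_above S" unfolding S_def by (rule bdd_aboveI[of _ 1]) auto
  define T where "T = Sup S"
  have T: "0 \<le> T" "T \<le> 1"
    unfolding T_def using cSup_upper[OF zero bdd] zero
    by (auto intro!: cSup_least simp: S_def)
  have below: "s \<in> S" if s: "0 \<le> s" "s < T" for s
  proof -
    obtain u where "u \<in> S" "s < u"
      using less_cSupE[of s S] s(2) zero unfolding T_def by blast
    then show ?thesis using s lift_restrict[of _ x y u s] by (auto simp: S_def)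
  qed
  have "T \<in> S"
  proof (cases "T = 0")
    case True
    then show ?thesis using zero by simp
  next
    case False
    then have "T > 0" using T by simp
    have "\<forall>s\<in>S. \<exists>p. lift p x y s" by (auto simp: S_def)
    from bchoice[OF this] obtain P where P: "\<And>s. s \<in> S \<Longrightarrow> lift (P s) x y s" by blast
    \<comment> \<open>By uniqueness the diagonal glues all partial lifts together.\<close>
    define p where "p t = P t t" for t
    have pP: "p t = P s t" if "s \<in> S" "0 \<le> t" "t \<le> s" for s t
    proof -
      have "t \<in> S" using that lift_restrict[OF P[OF that(1)] that(3)] by (auto simp: S_def)
      moreover have "s \<le> 1" using that by (simp add: S_def)
      ultimately show ?thesis
        unfolding p_def using lift_unique[OF P[of s] P[of t], of t] that by simp
    qed
    have p0: "p 0 = x" using P[OF zero] by (simp add: p_def lift_def)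
    have fp: "f (p t) = f x + t *\<^sub>R (y - f x)" if "t \<in> {0..<T}" for t
      using P[of t] below[of t] that by (simp add: p_def lift_def)
    have "(norm (y - f x) / \<eta> R)-lipschitz_on {0..<T} p"
    proof (rule lipschitz_on_leI)
      fix s t assume st: "s \<in> {0..<T}" "t \<in> {0..<T}" "s \<le> t"
      then have t: "t \<in> S" using below by simp
      have "\<eta> R * norm (P t t - P t s) \<le> norm (y - f x) * (t - s)"
        using st t by (intro lift_lipschitz[OF P[OF t]] lift_in_ball[OF P[OF t] _ _ _ R])
          (auto simp: S_def)
      then have "\<eta> R * norm (p t - p s) \<le> norm (y - f x) * (t - s)"
        using pP[OF t] st by simp
      then show "dist (p s) (p t) \<le> norm (y - f x) / \<eta> R * dist s t"
        using weight_pos[OF R(1)] st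
        by (simp add: dist_norm norm_minus_commute field_simps dist_real_def)
    qed (use weight_pos[OF R(1)] in simp)
    then have "uniformly_continuous_on {0..<T} p"
      by (rule lipschitz_on_uniformly_continuous)
    then obtain q where "uniformly_continuous_on (closure {0..<T}) q"
      and qp: "\<And>t. t \<in> {0..<T} \<Longrightarrow> p t = q t"
      using uniformly_continuous_on_extension_on_closure by metis
    then have cq: "continuous_on {0..T} q"
      using \<open>T > 0\<close> by (simp add: uniformly_continuous_imp_continuous)
    have fq: "f (q t) - (f x + t *\<^sub>R (y - f x)) = 0" if "t \<in> {0..T}" for t
    proof (rule continuous_constant_on_closure[of "{0..<T}"
          "\<lambda>t. f (q t) - (f x + t *\<^sub>R (y - f x))"])
      show "continuous_on (closure {0..<T}) (\<lambda>t. f (q t) - (f x + t *\<^sub>R (y - f x)))"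
        using \<open>T > 0\<close>
        by (auto intro!: continuous_intros continuous_on_compose2[OF continuous] cq)
    qed (use that \<open>T > 0\<close> fp qp in auto)
    have q0: "q 0 = x" using qp[of 0] p0 \<open>T > 0\<close> by simp
    have "lift q x y T"
      unfolding lift_def
    proof (intro conjI ballI)
      show "f (q t) = f x + t *\<^sub>R (y - f x)" if "t \<in> {0..T}" for t
        using fq[OF that] by (rule eq_iff_diff_eq_0[THEN iffD2])
    qed (fact cq q0)+
    then show ?thesis using T by (auto simp: S_def)
  qed
  moreover have "T = 1"
  proof (rule ccontr)
    assume "T \<noteq> 1"
    with T have "T < 1" by simp
    obtain T' q where T': "T' > T" "lift q x y T'"
      using \<open>T \<in> S\<close> lift_extend T unfolding S_def by blast
    then have "lift q x y (min T' 1)" using lift_restrict by simp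
    then have "min T' 1 \<in> S" using T T' by (auto simp: S_def)
    then have "min T' 1 \<le> T" unfolding T_def using bdd by (rule cSup_upper)
    with T' \<open>T < 1\<close> show False by simp
  qed
  ultimately show ?thesis by (simp add: S_def)
qed

lemma surjective: "surj f"
proof (rule surjI)
  fix y
  show "f ((SOME p. lift p 0 y 1) 1) = y"
    by (rule lift_end) (rule someI_ex[OF lift_exists])
qed

text \<open>
  The end point of the lift towards \<open>y\<close> is a locally constant function of its starting point, and
  a preimage of \<open>y\<close> is the end point of its own constant lift.
\<close>
lemma injective: "inj f"
proof (rule injI)
  fix a b assume ab: "f a = f b"
  define y where "y = f a"
  define P where "P x = (SOME p. lift p x y 1)" for x
  have P: "lift (P x) x y 1" for x
    unfolding P_def by (rule someI_ex[OF lift_exists])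
  have P_end: "f (P x 1) = y" for x
    using P by (rule lift_end)
  have const: "P x 1 = x" if "f x = y" for x
  proof -
    have "lift (\<lambda>_. x) x y 1" using that by (simp add: lift_def)
    from lift_unique[OF this P] show ?thesis by simp
  qed
  have "(\<lambda>x. P x 1) constant_on UNIV"
  proof (rule locally_constant_imp_constant[OF connected_UNIV])
    fix x :: 'a
    obtain \<epsilon> where \<epsilon>: "\<epsilon> > 0" and
      st: "\<And>q x' T' t. \<lbrakk>lift q x' y T'; T' \<le> 1; x' \<in> ball x \<epsilon>; t \<in> {0..T'}; f (P x t) = f (q t)\<rbrakk>
       \<Longrightarrow> q t = P x t" by (rule lift_stable[OF P[of x] order_refl]) (rule that)
    have same: "P x' 1 = P x 1" if "x' \<in> ball x \<epsilon>" for x'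
      by (rule st[OF P[of x'] order_refl that]) (simp_all add: P_end)
    show "\<exists>T. openin (top_of_set UNIV) T \<and> x \<in> T \<and> (\<forall>x'\<in>T. P x' 1 = P x 1)"
    proof (intro exI[of _ "ball x \<epsilon>"] conjI ballI)
      show "P x' 1 = P x 1" if "x' \<in> ball x \<epsilon>" for x' using that by (rule same)
    qed (use \<epsilon> in simp_all)
  qed
  then obtain e where e: "\<And>x. P x 1 = e" unfolding constant_on_def by blast
  have "a = P a 1" using const[of a] by (simp add: y_def)
  also have "\<dots> = P b 1" unfolding e ..
  also have "\<dots> = b" using const[of b] ab by (simp add: y_def)
  finally show "a = b" .
qed

text \<open>
  The a priori bound for lifts that start at 0 confines the inverse image of a ball around \<open>f 0\<close>
  to a ball of radius \<open>R\<close>.  A segment inside the first ball is mapped by \<open>inv f\<close> to its lift, so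
  \<open>1 / \<eta> R\<close> is a Lipschitz constant.
\<close>
lemma inverse_lipschitz_on_bounded:
  assumes "bounded B"
  shows "\<exists>L. L-lipschitz_on B (inv f)"
proof -
  have ff: "f (inv f y) = y" "inv f (f x) = x" for x y
    using surjective injective by (simp_all add: surj_f_inv_f)
  obtain M where "\<forall>y\<in>B. dist (f 0) y \<le> M"
    using assms bounded_any_center[of B "f 0"] by blast
  then have M: "B \<subseteq> cball (f 0) M" by auto
  obtain R where R: "R \<ge> 0" "F 0 + M < F R" using F_unbounded by blast
  have inR: "norm (inv f y) \<le> R" if "y \<in> cball (f 0) M" for y
  proof -
    obtain p where p: "lift p 0 y 1" using lift_exists by blast
    then have "f (p 1) = y" by (rule lift_end)
    then have "p 1 = inv f y" using ff(2)[of "p 1"] by simp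
    moreover have "norm (p 1) \<le> R"
      using that R by (intro lift_in_ball[OF p]) (auto simp: dist_norm norm_minus_commute)
    ultimately show ?thesis by simp
  qed
  have main: "\<eta> R * norm (inv f z - inv f y) \<le> norm (z - y)"
    if y: "y \<in> cball (f 0) M" and z: "z \<in> cball (f 0) M" for y z
  proof -
    obtain p where p: "lift p (inv f y) z 1" using lift_exists by blast
    have pt: "p t = inv f ((1 - t) *\<^sub>R y + t *\<^sub>R z)" if "t \<in> {0..1}" for t
    proof -
      have "f (p t) = y + t *\<^sub>R (z - y)" using p that by (simp add: lift_def ff(1))
      then have "f (p t) = (1 - t) *\<^sub>R y + t *\<^sub>R z" by (simp add: algebra_simps)
      then show ?thesis using ff(2)[of "p t"] by simp
    qed
    have "norm (p t) \<le> R" if "t \<in> {0..1}" for t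
      unfolding pt[OF that] using that by (intro inR convexD[OF convex_cball y z]) auto
    from lift_lipschitz[OF p this, of 0 1] show ?thesis using pt[of 0] pt[of 1] by (simp add: ff(1))
  qed
  have "(1 / \<eta> R)-lipschitz_on B (inv f)"
  proof (rule lipschitz_onI)
    fix y z assume "y \<in> B" "z \<in> B"
    then show "dist (inv f y) (inv f z) \<le> 1 / \<eta> R * dist y z"
      using main[OF subsetD[OF M] subsetD[OF M], of z y] weight_pos[OF R(1)]
      by (simp add: dist_norm field_simps)
  qed (use weight_pos[OF R(1)] in simp)
  then show ?thesis ..
qed

lemma global_homeomorphism: "homeomorphism UNIV UNIV f (inv f)"
proof (rule homeomorphismI)
  have "isCont (inv f) y" for y
  proof -
    obtain L where "L-lipschitz_on (ball y 1) (inv f)"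
      using inverse_lipschitz_on_bounded bounded_ball by blast
    then have "continuous_on (ball y 1) (inv f)" by (rule lipschitz_on_continuous_on)
    then show ?thesis by (simp add: continuous_on_eq_continuous_at)
  qed
  then show "continuous_on UNIV (inv f)" by (simp add: continuous_at_imp_continuous_on)
qed (simp_all add: continuous injective inv_f_f surj_f_inv_f[OF surjective])

end

section \<open>The global inversion theorem\<close>
theorem corollary3p11:
  fixes f g h :: "'a::banach \<Rightarrow> 'b::banach"
    and g' :: "'a \<Rightarrow> 'a \<Rightarrow>\<^sub>L 'b"
  assumes "reflexive_space TYPE('a)" and "reflexive_space TYPE('b)"
    and "frechet_smooth_norm TYPE('a)" and "frechet_smooth_norm TYPE('b)"
    and "\<And>x. f x = g x + h x"
    and "\<And>x. (g has_derivative blinfun_apply (g' x)) (at x)"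
    and "continuous_on UNIV g'"
    and "\<And>x. normed_isomorphism (blinfun_apply (g' x))"
    and "\<And>x. lipschitz_near h x"
    and "\<And>x. local_Lip h x < inverse_norm_recip (blinfun_apply (g' x))"
    and "(\<integral>\<^sup>+ t\<in>{0::real..}.
            (INF x\<in>{x. norm x \<le> t}. inverse_norm_recip (blinfun_apply (g' x)) - local_Lip h x)
          \<partial>lborel) = \<infinity>"
  shows "homeomorphism UNIV UNIV f (inv f) \<and>
         (\<forall>B. bounded B \<longrightarrow> (\<exists>L. L-lipschitz_on B (inv f)))"
proof (cases "\<exists>v::'a. v \<noteq> 0")
  \<comment> \<open>On the zero space \<open>\<parallel>T\<^sup>-\<^sup>1\<parallel>\<^sup>-\<^sup>1\<close> is infinite, so this case is kept apart from the real-valued estimates.\<close>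
  case False
  then have a0: "x = 0" for x :: 'a by simp
  have b0: "y = 0" for y :: 'b
    using normed_isomorphism_bounds(3)[OF assms(8)[of 0], of y] a0[of "inv (blinfun_apply (g' 0)) y"]
    by (simp add: blinfun.zero_right)
  have f0: "f = (\<lambda>_. 0)" by (rule ext) (rule b0)
  have i0: "inv f = (\<lambda>_. 0)" by (rule ext) (rule a0)
  have "homeomorphism UNIV UNIV f (inv f)"
    unfolding i0 unfolding f0
  proof (rule homeomorphismI)
    show "0 = x" for x :: 'a by (rule a0[symmetric])
    show "0 = y" for y :: 'b by (rule b0[symmetric])
  qed simp_all
  moreover have "0-lipschitz_on B (inv f)" for B by (simp add: i0 lipschitz_on_def)
  ultimately show ?thesis by blast
next
  case True
  then obtain v :: 'a where v: "v \<noteq> 0" by blast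
  define T where "T x = blinfun_apply (g' x)" for x
  have iso: "normed_isomorphism (T x)" for x unfolding T_def by (rule assms(8))
  have pos: "onorm (inv (T x)) > 0" for x
    using normed_isomorphism_bounds(2)[OF iso[of x], of v] v
      onorm_pos_le[of "inv (T x)"] iso[of x]
    by (cases "onorm (inv (T x)) = 0") (auto simp: normed_isomorphism_def less_le)
  define m where "m x = inverse_norm_recip (T x) - local_Lip h x" for x
  have m_pos: "m x > 0" for x
    unfolding m_def T_def by (rule diff_gr0_ennreal) (rule assms(10))
  have m_fin: "m x < top" for x
    using pos[of x] by (simp add: m_def inverse_norm_recip_def inverse_ennreal diff_less_top_ennreal)
  define E where "E t = (INF x\<in>{x. norm x \<le> t}. m x)" for t
  have E_le: "E t \<le> m x" if "norm x \<le> t" for t x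
    unfolding E_def using that by (intro INF_lower) simp
  have E_fin: "E t < top" if "0 \<le> t" for t
    using le_less_trans[OF E_le[of 0 t] m_fin[of 0]] that by simp
  define w where "w t = enn2real (E t)" for t
  have w: "ennreal (w t) = E t" if "0 \<le> t" for t
    using E_fin[OF that] by (simp add: w_def)
  have w_anti: "w t \<le> w s" if "0 \<le> s" "s \<le> t" for s t
  proof -
    have "E t \<le> E s" unfolding E_def using that by (intro INF_superset_mono) auto
    then show ?thesis unfolding w_def by (rule enn2real_mono) (rule E_fin[OF that(1)])
  qed
  have w_nonneg: "0 \<le> w t" for t by (simp add: w_def)
  have "(\<integral>\<^sup>+ t\<in>{0..}. ennreal (w t) \<partial>lborel) = (\<integral>\<^sup>+ t\<in>{0..}. E t \<partial>lborel)"
    by (rule nn_integral_cong) (auto simp: indicator_def w)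
  also have "\<dots> = \<infinity>" using assms(11) by (simp only: E_def m_def T_def)
  finally have div: "(\<integral>\<^sup>+ t\<in>{0..}. ennreal (w t) \<partial>lborel) = \<infinity>" .
  obtain F where F: "\<And>s t. 0 \<le> s \<Longrightarrow> s \<le> t \<Longrightarrow> F s \<le> F t"
    "\<And>s t. 0 \<le> s \<Longrightarrow> s \<le> t \<Longrightarrow> F t - F s \<le> w s * (t - s)"
    "\<And>M. \<exists>r\<ge>0. M < F r"
    by (rule primitive_of_antimono_weight[OF w_nonneg w_anti div]) (assumption | rule that)+
  \<comment> \<open>Expansion holds only with factors strictly below \<open>m x\<close>; halving the weight costs nothing, as
     its integral still diverges.\<close>
  define c where "c x = enn2real (m x) / 2" for x
  have c: "0 < c x" "ennreal (c x) < m x" "w (norm x) / 2 \<le> c x" for x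
  proof -
    have m: "m x = ennreal (2 * c x)" using m_fin[of x] by (simp add: c_def)
    then show "0 < c x" using m_pos[of x] by simp
    then show "ennreal (c x) < m x" by (simp add: m ennreal_less_iff)
    show "w (norm x) / 2 \<le> c x"
      using E_le[of x "norm x"] m_fin[of x] by (simp add: w_def c_def enn2real_mono)
  qed
  define k where "k x u = f u - T x u" for x u
  have local: "\<exists>r>0. (1 / onorm (inv (T x)) - c x)-lipschitz_on (ball x r) (k x)" for x
  proof -
    have "isCont g' x" using assms(7) by (simp add: continuous_on_eq_continuous_at)
    then obtain r where "r > 0"
      "(1 / onorm (inv (T x)) - c x)-lipschitz_on (ball x r) (\<lambda>u. g u + h u - T x u)"
      using perturbation_lipschitz_near[OF assms(6), of x "c x" h] pos[of x] c(1,2)[of x]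
      unfolding m_def T_def by blast
    then show ?thesis unfolding k_def assms(5) by blast
  qed
  interpret weighted_expansion f "\<lambda>t. w t / 2" "\<lambda>t. F t / 2"
  proof
    have "isCont f x" for x
    proof -
      obtain r L where "r > 0" "L-lipschitz_on (ball x r) h"
        using assms(9)[of x] unfolding lipschitz_near_def by blast
      then have "isCont h x"
        using lipschitz_on_continuous_on[of L "ball x r" h]
        by (simp add: continuous_on_eq_continuous_at)
      moreover have "isCont g x" using assms(6) by (rule has_derivative_continuous)
      ultimately show ?thesis unfolding assms(5)[abs_def] by (rule continuous_add[rotated])
    qed
    then show "continuous_on UNIV f" by (simp add: continuous_at_imp_continuous_on)
  next
    fix x
    obtain r where r: "r > 0" "(1 / onorm (inv (T x)) - c x)-lipschitz_on (ball x r) (k x)"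
      using local by blast
    have "w (norm x) / 2 * norm (u - v) \<le> norm (f u - f v)"
      if "u \<in> ball x r" "v \<in> ball x r" for u v
    proof -
      have "w (norm x) / 2 * norm (u - v) \<le> c x * norm (u - v)"
        using c(3) by (intro mult_right_mono) auto
      also have "\<dots> \<le> norm (f u - f v)"
        using perturbed_isomorphism_expansive[OF iso[of x] pos[of x] r(2) that]
        by (simp add: k_def)
      finally show ?thesis .
    qed
    with r(1) show "\<exists>r>0. \<forall>u\<in>ball x r. \<forall>v\<in>ball x r.
        w (norm x) / 2 * norm (u - v) \<le> norm (f u - f v)" by blast
  next
    fix x and s :: real assume s: "s > 0"
    obtain r where r: "r > 0" "(1 / onorm (inv (T x)) - c x)-lipschitz_on (ball x r) (k x)"
      using local by blast
    have "(1 / onorm (inv (T x)) - c x) * onorm (inv (T x)) < 1"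
      using pos[of x] c(1)[of x] by (simp add: left_diff_distrib)
    then have "\<exists>\<rho>>0. ball (T x x + k x x) \<rho> \<subseteq> (\<lambda>u. T x u + k x u) ` ball x (min r s)"
      using r s by (intro perturbed_isomorphism_open[OF iso pos lipschitz_on_subset[OF r(2)]]) auto
    then have "\<exists>\<rho>>0. ball (f x) \<rho> \<subseteq> f ` ball x (min r s)" unfolding k_def by simp
    moreover have "f ` ball x (min r s) \<subseteq> f ` ball x s" by (intro image_mono) auto
    ultimately show "\<exists>\<rho>>0. ball (f x) \<rho> \<subseteq> f ` ball x s" by blast
  next
    fix s t :: real assume st: "0 \<le> s" "s \<le> t"
    show "w t / 2 \<le> w s / 2" using w_anti[OF st] by simp
    show "F s / 2 \<le> F t / 2" using F(1)[OF st] by simp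
    show "F t / 2 - F s / 2 \<le> w s / 2 * (t - s)" using F(2)[OF st] by simp
  next
    fix M :: real
    show "\<exists>r\<ge>0. M < F r / 2" using F(3)[of "2 * M"] by (auto intro: exI)
  qed
  show ?thesis using global_homeomorphism inverse_lipschitz_on_bounded by blast
qed

end
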